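(* Let $\Phi,\alpha,\beta:\mathbb{R}\to\mathbb{R}$ be given functions with $\alpha,\beta$ continuous, $\alpha>0$, and $\beta'=-\alpha\,\Phi'$. Let $\ell\ge 0$ be an integer and $q=2+2\ell$. Consider the semidiscrete finite volume scheme for the one-dimensional Euler equations with gravity $$\frac{\mathrm{d}}{\mathrm{d}t}\overline{U}_j(t)=-\frac{1}{\Delta x}\left[\mathcal{F}\left(U^+_{j+1/2}(t),U^-_{j+1/2}(t)\right)-\mathcal{F}\left(U^+_{j-1/2}(t),U^-_{j-1/2}(t)\right)\right]+Q_j^q(t),\qquad j\in\mathbb{Z},$$ where $\mathcal{F}$ is any consistent numerical flux, the boundary extrapolated data $U^\pm_{j+1/2}$ are obtained from the cell averages $\overline{U}_j=(\overline{\rho}_j,\overline{m}_j,\overline{E}_j)$ by the high order well-balanced reconstruction described in the context, and $Q_j^q=(0,Q_j^q[\rho],Q_j^q[m])$ where $Q^q_j[y]$ is the Romberg-extrapolated well-balanced quadrature described in the context. Then the scheme is exactly well balanced on the hydrostatic equilibrium solution $\rho(x,t)=\alpha(x)$, $v(x,t)=0$, $p(x,t)=\beta(x)$; that is, if the cell averages are those of this equilibrium, the right-hand side of the scheme is exactly zero for every $j$.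
   Context: Equations: the one-dimensional Euler equations with gravity for an ideal gas with constant $\gamma>1$ are $\partial_t U+\partial_x f(U)=S$ with $U=(\rho,m,E)$, $m=\rho v$, $f(U)=(\rho v,\ \rho v^2+p,\ v(E+p))$, $p=(\gamma-1)\left(E-\tfrac12 m^2/\rho\right)$, $S=(0,-\rho\Phi',-\rho v\Phi')$. Grid: $\Delta x>0$, $x_j=j\Delta x$, $x_{j\pm1/2}=x_j\pm\Delta x/2$, $j\in\mathbb{Z}$; the $j$-th cell is $(x_{j-1/2},x_{j+1/2})$. An overbar with subscript $j$ denotes the cell average over the $j$-th cell, e.g. $\overline{\alpha}_j=\frac1{\Delta x}\int_{x_{j-1/2}}^{x_{j+1/2}}\alpha\,\mathrm{d}x$. Numerical flux: a function $\mathcal{F}(a,b)$ is consistent if $\mathcal{F}(U,U)=f(U)$ for all states $U$. Reconstruction: a piecewise polynomial reconstruction assigns to a sequence of cell averages $(\overline{g}_i)_{i\in\mathbb{Z}}$ a polynomial $g_j(x)$ in each cell $j$; it reproduces constants exactly, so in particular it maps zero cell averages to the zero polynomial in every cell. For a reconstructed quantity, $g^-_{j+1/2}=g_j(x_{j+1/2})$ and $g^+_{j+1/2}=g_{j+1}(x_{j+1/2})$. High order well-balanced reconstruction: set $\overline{r}_j=\overline{\rho}_j-\overline{\alpha}_j$; reconstruct $r_j(x)$ and $m_j(x)$ from $\overline{r}$ and $\overline{m}$; set $\rho_j(x)=r_j(x)+\alpha(x)$. With a fixed quadrature rule on each cell with nodes $x_{j,k}$ and weights $w_k$, set $\overline{K}_j=\frac12\sum_k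 w_k\, m_j(x_{j,k})^2/\rho_j(x_{j,k})$, $\overline{p}_j=(\gamma-1)(\overline{E}_j-\overline{K}_j)$, $\overline{\pi}_j=\overline{p}_j-\overline{\beta}_j$; reconstruct $\pi_j(x)$ from $\overline{\pi}$ and set $p_j(x)=\pi_j(x)+\beta(x)$. At the interfaces, $\rho^\pm_{j+1/2}=r^\pm_{j+1/2}+\alpha(x_{j+1/2})$, $p^\pm_{j+1/2}=\pi^\pm_{j+1/2}+\beta(x_{j+1/2})$, $E^\pm_{j+1/2}=\frac{p^\pm_{j+1/2}}{\gamma-1}+\frac12\frac{(m^\pm_{j+1/2})^2}{\rho^\pm_{j+1/2}}$, and $U^\pm_{j+1/2}=(\rho^\pm_{j+1/2},m^\pm_{j+1/2},E^\pm_{j+1/2})$. Well-balanced quadrature: for $y\in\{\rho,m\}$ with in-cell reconstruction $y_j(x)$ and for $n=2^s$, $s\ge0$, let $z_i=x_{j-1/2}+i\Delta x/n$, $i=0,\dots,n$, and $$Q^{(0)}_{n}[y]=\sum_{i=1}^{n}\frac12\left(\frac{y_j(z_{i-1})}{\alpha(z_{i-1})}+\frac{y_j(z_i)}{\alpha(z_i)}\right)\frac{\beta(z_i)-\beta(z_{i-1})}{\Delta x}$$ (the composite rule for the cell average of $\frac{y}{\alpha}\beta'=-y\Phi'$). Romberg recursion: $Q^{(k)}_n[y]=\dfrac{2^{2k}Q^{(k-1)}_n[y]-Q^{(k-1)}_{n/2}[y]}{2^{2k}-1}$ for integers $k>0$ and $n=2^s$ with $s\ge k$. Finally $Q^q_j[y]=Q^{(\ell)}_{2^\ell}[y]$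 with $q=2+2\ell$. Equilibrium cell averages: $\overline{\rho}_j=\overline{\alpha}_j$, $\overline{m}_j=0$, $\overline{E}_j=\overline{\beta}_j/(\gamma-1)$ for all $j$. *)

theory Defs
  imports "HOL-Analysis.Analysis" "HOL-Computational_Algebra.Polynomial"
begin

text \<open>A state is a triple (density, momentum, total energy).\<close>

type_synonym state = "real \<times> real \<times> real"

definition dens :: "state \<Rightarrow> real" where "dens U = fst U"
definition mom :: "state \<Rightarrow> real" where "mom U = fst (snd U)"
definition energy :: "state \<Rightarrow> real" where "energy U = snd (snd U)"

definition velocity :: "state \<Rightarrow> real" where
  "velocity U = mom U / dens U"

definition pressure :: "real \<Rightarrow> state \<Rightarrow> real" where
  "pressure \<gamma> U = (\<gamma> - 1) * (energy U - 1/2 * (mom U)\<^sup>2 / dens U)"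

definition euler_flux :: "real \<Rightarrow> state \<Rightarrow> state" where
  "euler_flux \<gamma> U =
     (dens U * velocity U,
      dens U * (velocity U)\<^sup>2 + pressure \<gamma> U,
      velocity U * (energy U + pressure \<gamma> U))"

text \<open>
  The Euler flux is meaningful for positive density, so consistency is required exactly there.
  The sign of the pressure is left free, because the equilibrium pressure is not assumed positive.
\<close>

definition consistent_flux :: "real \<Rightarrow> (state \<Rightarrow> state \<Rightarrow> state) \<Rightarrow> bool" where
  "consistent_flux \<gamma> F \<longleftrightarrow> (\<forall>U. dens U > 0 \<longrightarrow> F U U = euler_flux \<gamma> U)"

text \<open>
  Half-integer indices are encoded by the integer below them: \<open>xface dx j\<close> is
  $x_{j+1/2} = x_j + \Delta x/2$, and hence cell \<open>j\<close> extends from \<open>xface dx (j - 1)\<close> to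
  \<open>xface dx j\<close>. All interface quantities below use the same convention.
\<close>

definition xface :: "real \<Rightarrow> int \<Rightarrow> real" where
  "xface dx j = of_int j * dx + dx / 2"

definition cell_avg :: "real \<Rightarrow> (real \<Rightarrow> real) \<Rightarrow> int \<Rightarrow> real" where
  "cell_avg dx g j = 1 / dx * integral {xface dx (j - 1)..xface dx j} g"

text \<open>
  A reconstruction may depend nonlinearly on the whole sequence of cell averages. The
  polynomials are in the global coordinate.
\<close>

type_synonym reconstruction = "(int \<Rightarrow> real) \<Rightarrow> int \<Rightarrow> real poly"

definition reproduces_constants :: "reconstruction \<Rightarrow> bool" where
  "reproduces_constants R \<longleftrightarrow> (\<forall>c j. R (\<lambda>_. c) j = [:c:])"

definition trace_minus :: "real \<Rightarrow> (int \<Rightarrow> real poly) \<Rightarrow> int \<Rightarrow> real" where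
  "trace_minus dx g j = poly (g j) (xface dx j)"

definition trace_plus :: "real \<Rightarrow> (int \<Rightarrow> real poly) \<Rightarrow> int \<Rightarrow> real" where
  "trace_plus dx g j = poly (g (j + 1)) (xface dx j)"

text \<open>
  A quadrature rule is given by its number \<open>N\<close> of nodes, the nodes \<open>xq j k\<close> in the closed cell
  \<open>j\<close>, and the weights \<open>w k\<close>, normalised as weights for a cell average.
\<close>

definition nodes_in_cells :: "real \<Rightarrow> nat \<Rightarrow> (int \<Rightarrow> nat \<Rightarrow> real) \<Rightarrow> bool" where
  "nodes_in_cells dx N xq \<longleftrightarrow> (\<forall>j. \<forall>k<N. xq j k \<in> {xface dx (j - 1)..xface dx j})"

definition r_rec :: "real \<Rightarrow> (real \<Rightarrow> real) \<Rightarrow> reconstruction \<Rightarrow> (int \<Rightarrow> state) \<Rightarrow> int \<Rightarrow> real poly" where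
  "r_rec dx \<alpha> R Ub = R (\<lambda>j. dens (Ub j) - cell_avg dx \<alpha> j)"

definition m_rec :: "reconstruction \<Rightarrow> (int \<Rightarrow> state) \<Rightarrow> int \<Rightarrow> real poly" where
  "m_rec R Ub = R (\<lambda>j. mom (Ub j))"

definition rho_rec :: "real \<Rightarrow> (real \<Rightarrow> real) \<Rightarrow> reconstruction \<Rightarrow> (int \<Rightarrow> state) \<Rightarrow> int \<Rightarrow> real \<Rightarrow> real" where
  "rho_rec dx \<alpha> R Ub j x = poly (r_rec dx \<alpha> R Ub j) x + \<alpha> x"

definition kin_avg ::
  "real \<Rightarrow> (real \<Rightarrow> real) \<Rightarrow> reconstruction \<Rightarrow> nat \<Rightarrow> (nat \<Rightarrow> real) \<Rightarrow> (int \<Rightarrow> nat \<Rightarrow> real)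
    \<Rightarrow> (int \<Rightarrow> state) \<Rightarrow> int \<Rightarrow> real" where
  "kin_avg dx \<alpha> R N w xq Ub j =
     1/2 * (\<Sum>k<N. w k * (poly (m_rec R Ub j) (xq j k))\<^sup>2 / rho_rec dx \<alpha> R Ub j (xq j k))"

definition p_avg ::
  "real \<Rightarrow> real \<Rightarrow> (real \<Rightarrow> real) \<Rightarrow> reconstruction \<Rightarrow> nat \<Rightarrow> (nat \<Rightarrow> real) \<Rightarrow> (int \<Rightarrow> nat \<Rightarrow> real)
    \<Rightarrow> (int \<Rightarrow> state) \<Rightarrow> int \<Rightarrow> real" where
  "p_avg \<gamma> dx \<alpha> R N w xq Ub j = (\<gamma> - 1) * (energy (Ub j) - kin_avg dx \<alpha> R N w xq Ub j)"

definition pi_rec ::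
  "real \<Rightarrow> real \<Rightarrow> (real \<Rightarrow> real) \<Rightarrow> (real \<Rightarrow> real) \<Rightarrow> reconstruction \<Rightarrow> nat \<Rightarrow> (nat \<Rightarrow> real)
    \<Rightarrow> (int \<Rightarrow> nat \<Rightarrow> real) \<Rightarrow> (int \<Rightarrow> state) \<Rightarrow> int \<Rightarrow> real poly" where
  "pi_rec \<gamma> dx \<alpha> \<beta> R N w xq Ub = R (\<lambda>j. p_avg \<gamma> dx \<alpha> R N w xq Ub j - cell_avg dx \<beta> j)"

definition state_of :: "real \<Rightarrow> real \<Rightarrow> real \<Rightarrow> real \<Rightarrow> state" where
  "state_of \<gamma> \<rho> m p = (\<rho>, m, p / (\<gamma> - 1) + 1/2 * m\<^sup>2 / \<rho>)"

definition U_minus ::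
  "real \<Rightarrow> real \<Rightarrow> (real \<Rightarrow> real) \<Rightarrow> (real \<Rightarrow> real) \<Rightarrow> reconstruction \<Rightarrow> nat \<Rightarrow> (nat \<Rightarrow> real)
    \<Rightarrow> (int \<Rightarrow> nat \<Rightarrow> real) \<Rightarrow> (int \<Rightarrow> state) \<Rightarrow> int \<Rightarrow> state" where
  "U_minus \<gamma> dx \<alpha> \<beta> R N w xq Ub j =
     state_of \<gamma>
       (trace_minus dx (r_rec dx \<alpha> R Ub) j + \<alpha> (xface dx j))
       (trace_minus dx (m_rec R Ub) j)
       (trace_minus dx (pi_rec \<gamma> dx \<alpha> \<beta> R N w xq Ub) j + \<beta> (xface dx j))"

definition U_plus ::
  "real \<Rightarrow> real \<Rightarrow> (real \<Rightarrow> real) \<Rightarrow> (real \<Rightarrow> real) \<Rightarrow> reconstruction \<Rightarrow> nat \<Rightarrow> (nat \<Rightarrow> real)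
    \<Rightarrow> (int \<Rightarrow> nat \<Rightarrow> real) \<Rightarrow> (int \<Rightarrow> state) \<Rightarrow> int \<Rightarrow> state" where
  "U_plus \<gamma> dx \<alpha> \<beta> R N w xq Ub j =
     state_of \<gamma>
       (trace_plus dx (r_rec dx \<alpha> R Ub) j + \<alpha> (xface dx j))
       (trace_plus dx (m_rec R Ub) j)
       (trace_plus dx (pi_rec \<gamma> dx \<alpha> \<beta> R N w xq Ub) j + \<beta> (xface dx j))"

text \<open>
  In the next three definitions \<open>y\<close> is the in-cell reconstruction of the density or the momentum
  in cell \<open>j\<close>, as a function of the global coordinate.
\<close>

definition subnode :: "real \<Rightarrow> int \<Rightarrow> nat \<Rightarrow> nat \<Rightarrow> real" where
  "subnode dx j n i = xface dx (j - 1) + real i * dx / real n"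

definition composite_quad ::
  "real \<Rightarrow> (real \<Rightarrow> real) \<Rightarrow> (real \<Rightarrow> real) \<Rightarrow> int \<Rightarrow> (real \<Rightarrow> real) \<Rightarrow> nat \<Rightarrow> real" where
  "composite_quad dx \<alpha> \<beta> j y n =
     (\<Sum>i=1..n. 1/2 * (y (subnode dx j n (i - 1)) / \<alpha> (subnode dx j n (i - 1))
                     + y (subnode dx j n i) / \<alpha> (subnode dx j n i))
               * ((\<beta> (subnode dx j n i) - \<beta> (subnode dx j n (i - 1))) / dx))"

text \<open>
  \<open>romberg dx \<alpha> \<beta> j y k n\<close> is $Q^{(k)}_n[y]$; it is meaningful only for $n = 2^s$ with $s \ge k$,
  in which case every \<open>n div 2\<close> in the recursion is exact.
\<close>

fun romberg ::
  "real \<Rightarrow> (real \<Rightarrow> real) \<Rightarrow> (real \<Rightarrow> real) \<Rightarrow> int \<Rightarrow> (real \<Rightarrow> real) \<Rightarrow> nat \<Rightarrow> nat \<Rightarrow> real" where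
  "romberg dx \<alpha> \<beta> j y 0 n = composite_quad dx \<alpha> \<beta> j y n"
| "romberg dx \<alpha> \<beta> j y (Suc k) n =
     (2 ^ (2 * Suc k) * romberg dx \<alpha> \<beta> j y k n - romberg dx \<alpha> \<beta> j y k (n div 2))
       / (2 ^ (2 * Suc k) - 1)"

text \<open>The quadrature $Q^q_j[y]$ of order $q = 2 + 2\ell$, indexed by $\ell$.\<close>

definition wb_quad ::
  "real \<Rightarrow> (real \<Rightarrow> real) \<Rightarrow> (real \<Rightarrow> real) \<Rightarrow> nat \<Rightarrow> int \<Rightarrow> (real \<Rightarrow> real) \<Rightarrow> real" where
  "wb_quad dx \<alpha> \<beta> l j y = romberg dx \<alpha> \<beta> j y l (2 ^ l)"

definition wb_source ::
  "real \<Rightarrow> (real \<Rightarrow> real) \<Rightarrow> (real \<Rightarrow> real) \<Rightarrow> reconstruction \<Rightarrow> nat \<Rightarrow> (int \<Rightarrow> state) \<Rightarrow> int \<Rightarrow> state" where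
  "wb_source dx \<alpha> \<beta> R l Ub j =
     (0, wb_quad dx \<alpha> \<beta> l j (rho_rec dx \<alpha> R Ub j), wb_quad dx \<alpha> \<beta> l j (poly (m_rec R Ub j)))"

definition scheme_rhs ::
  "real \<Rightarrow> real \<Rightarrow> (real \<Rightarrow> real) \<Rightarrow> (real \<Rightarrow> real) \<Rightarrow> (state \<Rightarrow> state \<Rightarrow> state) \<Rightarrow> reconstruction
    \<Rightarrow> nat \<Rightarrow> (nat \<Rightarrow> real) \<Rightarrow> (int \<Rightarrow> nat \<Rightarrow> real) \<Rightarrow> nat \<Rightarrow> (int \<Rightarrow> state) \<Rightarrow> int \<Rightarrow> state" where
  "scheme_rhs \<gamma> dx \<alpha> \<beta> F R N w xq l Ub j =
     - (1 / dx) *\<^sub>R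
       (F (U_plus \<gamma> dx \<alpha> \<beta> R N w xq Ub j) (U_minus \<gamma> dx \<alpha> \<beta> R N w xq Ub j)
        - F (U_plus \<gamma> dx \<alpha> \<beta> R N w xq Ub (j - 1)) (U_minus \<gamma> dx \<alpha> \<beta> R N w xq Ub (j - 1)))
     + wb_source dx \<alpha> \<beta> R l Ub j"

text \<open>
  Cell averages of the equilibrium with density \<open>\<alpha>\<close>, zero velocity and pressure \<open>\<beta>\<close>.
\<close>

definition equilibrium_avg ::
  "real \<Rightarrow> real \<Rightarrow> (real \<Rightarrow> real) \<Rightarrow> (real \<Rightarrow> real) \<Rightarrow> int \<Rightarrow> state" where
  "equilibrium_avg \<gamma> dx \<alpha> \<beta> j = (cell_avg dx \<alpha> j, 0, cell_avg dx \<beta> j / (\<gamma> - 1))"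

end

theory Submission imports Defs begin

text \<open>
  At the equilibrium all three deviations from \<open>\<alpha>\<close>, \<open>0\<close> and \<open>\<beta>\<close> have zero cell averages, so the
  reconstruction returns \<open>\<alpha>\<close>, \<open>0\<close>, \<open>\<beta>\<close> exactly. The interface traces from both sides then agree
  and, by consistency, the flux is $(0, \beta(x_{j+1/2}), 0)$. For \<open>y = \<alpha>\<close> every composite rule
  telescopes to the exact difference quotient of \<open>\<beta>\<close> over the cell, whatever the number of
  subintervals, and Romberg extrapolation of a constant sequence leaves it unchanged; this cancels
  the flux difference.
\<close>

text \<open>The two weights in each extrapolation step sum to 1, so a common value \<open>c\<close>
  survives. The bound \<open>k \<le> s\<close> keeps every halved argument a power of two.\<close>

lemma romberg_const:
  assumes "\<And>s. composite_quad dx \<alpha> \<beta> j y (2 ^ s) = c" and "k \<le> s"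
  shows "romberg dx \<alpha> \<beta> j y k (2 ^ s) = c"
  using assms(2)
proof (induction k arbitrary: s)
  case 0
  then show ?case by (simp add: assms(1))
next
  case (Suc k)
  then obtain s' where s: "s = Suc s'" and "k \<le> s'"
    by (cases s) auto
  then have "romberg dx \<alpha> \<beta> j y k (2 ^ s) = c" "romberg dx \<alpha> \<beta> j y k (2 ^ s div 2) = c"
    using Suc.IH[of s] Suc.IH[of s'] by simp_all
  moreover have "(2::real) ^ (2 * Suc k) \<noteq> 1"
    using one_less_power[of "2::real" "2 * Suc k"] by simp
  ultimately show ?case
    by (simp add: divide_simps algebra_simps)
qed

lemma wb_quad_const:
  assumes "\<And>s. composite_quad dx \<alpha> \<beta> j y (2 ^ s) = c"
  shows "wb_quad dx \<alpha> \<beta> l j y = c"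
  unfolding wb_quad_def by (rule romberg_const) (simp_all add: assms)

text \<open>For \<open>y = \<alpha>\<close> each quotient is 1, so the trapezoidal mean drops out
  and only increments of \<open>\<beta>\<close> remain.\<close>

lemma composite_quad_density:
  assumes "n > 0" and nz: "\<And>x. \<alpha> x \<noteq> 0"
  shows "composite_quad dx \<alpha> \<beta> j \<alpha> n = (\<beta> (xface dx j) - \<beta> (xface dx (j - 1))) / dx"
proof -
  have "composite_quad dx \<alpha> \<beta> j \<alpha> n
      = (\<Sum>i=1..n. (\<beta> (subnode dx j n i) - \<beta> (subnode dx j n (i - 1)))) / dx"
    by (simp add: composite_quad_def nz sum_divide_distrib)
  also have "(\<Sum>i=1..n. (\<beta> (subnode dx j n i) - \<beta> (subnode dx j n (i - 1))))
      = \<beta> (subnode dx j n n) - \<beta> (subnode dx j n 0)"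
    using sum_telescope''[of 0 n "\<lambda>i. \<beta> (subnode dx j n i)"] by simp
  \<comment> \<open>Needs \<open>n > 0\<close>: for \<open>n = 0\<close> division by zero would
    place the last subnode at the left face.\<close>
  also have "\<dots> = \<beta> (xface dx j) - \<beta> (xface dx (j - 1))"
    using \<open>n > 0\<close> by (simp add: subnode_def xface_def algebra_simps)
  finally show ?thesis .
qed

lemma wb_quad_density:
  assumes "\<And>x. \<alpha> x \<noteq> 0"
  shows "wb_quad dx \<alpha> \<beta> l j \<alpha> = (\<beta> (xface dx j) - \<beta> (xface dx (j - 1))) / dx"
  by (rule wb_quad_const) (simp add: composite_quad_density assms)

lemma wb_quad_zero: "wb_quad dx \<alpha> \<beta> l j (\<lambda>_. 0) = 0"
  by (rule wb_quad_const) (simp add: composite_quad_def)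

lemma reproduces_constants_zero:
  assumes "reproduces_constants R"
  shows "R (\<lambda>_. 0) j = 0"
  using assms by (simp add: reproduces_constants_def)

context
  fixes \<gamma> dx :: real and \<alpha> \<beta> :: "real \<Rightarrow> real" and R :: reconstruction
  assumes R: "reproduces_constants R"
begin

lemma r_rec_equilibrium: "r_rec dx \<alpha> R (equilibrium_avg \<gamma> dx \<alpha> \<beta>) j = 0"
  by (simp add: r_rec_def equilibrium_avg_def dens_def reproduces_constants_zero[OF R])

lemma m_rec_equilibrium: "m_rec R (equilibrium_avg \<gamma> dx \<alpha> \<beta>) j = 0"
  by (simp add: m_rec_def equilibrium_avg_def mom_def reproduces_constants_zero[OF R])

text \<open>Zero momentum kills every term of the kinetic quadrature; the factors
  \<open>\<gamma> - 1\<close> then cancel, so \<open>p_avg\<close> is the cell average of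
  \<open>\<beta>\<close>.\<close>

lemma pi_rec_equilibrium:
  assumes "\<gamma> \<noteq> 1"
  shows "pi_rec \<gamma> dx \<alpha> \<beta> R N w xq (equilibrium_avg \<gamma> dx \<alpha> \<beta>) j = 0"
proof -
  have "p_avg \<gamma> dx \<alpha> R N w xq (equilibrium_avg \<gamma> dx \<alpha> \<beta>) i = cell_avg dx \<beta> i" for i
    using assms
    by (simp add: p_avg_def kin_avg_def m_rec_equilibrium equilibrium_avg_def energy_def)
  then show ?thesis
    by (simp add: pi_rec_def reproduces_constants_zero[OF R])
qed

lemma U_equilibrium:
  assumes "\<gamma> \<noteq> 1"
  shows "U_minus \<gamma> dx \<alpha> \<beta> R N w xq (equilibrium_avg \<gamma> dx \<alpha> \<beta>) j
           = state_of \<gamma> (\<alpha> (xface dx j)) 0 (\<beta> (xface dx j))"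
    and "U_plus \<gamma> dx \<alpha> \<beta> R N w xq (equilibrium_avg \<gamma> dx \<alpha> \<beta>) j
           = state_of \<gamma> (\<alpha> (xface dx j)) 0 (\<beta> (xface dx j))"
  by (simp_all add: U_minus_def U_plus_def trace_minus_def trace_plus_def
      r_rec_equilibrium m_rec_equilibrium pi_rec_equilibrium[OF assms])

lemma wb_source_equilibrium:
  assumes "\<And>x. \<alpha> x \<noteq> 0"
  shows "wb_source dx \<alpha> \<beta> R l (equilibrium_avg \<gamma> dx \<alpha> \<beta>) j
           = (0, (\<beta> (xface dx j) - \<beta> (xface dx (j - 1))) / dx, 0)"
proof -
  have "rho_rec dx \<alpha> R (equilibrium_avg \<gamma> dx \<alpha> \<beta>) j = \<alpha>"
    by (simp add: fun_eq_iff rho_rec_def r_rec_equilibrium)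
  moreover have "poly (m_rec R (equilibrium_avg \<gamma> dx \<alpha> \<beta>) j) = (\<lambda>_. 0)"
    by (simp add: fun_eq_iff m_rec_equilibrium)
  ultimately show ?thesis
    by (simp add: wb_source_def wb_quad_zero wb_quad_density assms)
qed

end

text \<open>At zero momentum the only surviving flux entry is the pressure, and
  \<open>pressure\<close> undoes the energy formula in \<open>state_of\<close>.\<close>

lemma euler_flux_at_rest:
  assumes "\<gamma> \<noteq> 1"
  shows "euler_flux \<gamma> (state_of \<gamma> \<rho> 0 p) = (0, p, 0)"
  using assms
  by (simp add: euler_flux_def state_of_def dens_def mom_def energy_def velocity_def pressure_def)

theorem theorem2:
  fixes \<gamma> dx :: real
    and \<Phi> \<alpha> \<beta> :: "real \<Rightarrow> real"
    and F :: "state \<Rightarrow> state \<Rightarrow> state"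
    and R :: reconstruction
    and N l :: nat
    and w :: "nat \<Rightarrow> real"
    and xq :: "int \<Rightarrow> nat \<Rightarrow> real"
    and Ub :: "int \<Rightarrow> state"
  assumes "\<gamma> > 1"
    and "dx > 0"
    and "continuous_on UNIV \<alpha>"
    and "continuous_on UNIV \<beta>"
    and "\<And>x. \<alpha> x > 0"
    and "\<And>x. \<Phi> differentiable (at x)"
    and "\<And>x. (\<beta> has_real_derivative - (\<alpha> x * deriv \<Phi> x)) (at x)"
    and "consistent_flux \<gamma> F"
    and "reproduces_constants R"
    and "nodes_in_cells dx N xq"
    and "\<And>j. Ub j = equilibrium_avg \<gamma> dx \<alpha> \<beta> j"
  shows "\<forall>j. scheme_rhs \<gamma> dx \<alpha> \<beta> F R N w xq l Ub j = 0"
proof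
  fix j
  have \<gamma>: "\<gamma> \<noteq> 1" and nz: "\<And>x. \<alpha> x \<noteq> 0"
    using \<open>\<gamma> > 1\<close> \<open>\<And>x. \<alpha> x > 0\<close> by (auto simp: less_le)
  \<comment> \<open>Equality as functions, since a reconstruction takes the whole sequence of
    averages.\<close>
  have Ub: "Ub = equilibrium_avg \<gamma> dx \<alpha> \<beta>"
    using assms(11) by (rule ext)
  have flux: "F (U_plus \<gamma> dx \<alpha> \<beta> R N w xq Ub i) (U_minus \<gamma> dx \<alpha> \<beta> R N w xq Ub i)
      = (0, \<beta> (xface dx i), 0)" for i
  proof -
    let ?U = "state_of \<gamma> (\<alpha> (xface dx i)) 0 (\<beta> (xface dx i))"
    have "dens ?U > 0"
      using \<open>\<And>x. \<alpha> x > 0\<close> by (simp add: dens_def state_of_def)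
    then have "F ?U ?U = (0, \<beta> (xface dx i), 0)"
      using \<open>consistent_flux \<gamma> F\<close> euler_flux_at_rest[OF \<gamma>] unfolding consistent_flux_def by metis
    then show ?thesis
      by (simp add: Ub U_equilibrium[OF \<open>reproduces_constants R\<close> \<gamma>])
  qed
  show "scheme_rhs \<gamma> dx \<alpha> \<beta> F R N w xq l Ub j = 0"
    \<comment> \<open>\<open>flux\<close> is stated for \<open>Ub\<close>, so it is applied before
      \<open>Ub\<close> is replaced.\<close>
    unfolding scheme_rhs_def flux unfolding Ub wb_source_equilibrium[OF \<open>reproduces_constants R\<close> nz]
    by (simp add: zero_prod_def diff_divide_distrib)
qed

end
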